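(* For every integer $h\ge 2$, the generating function $f_h(x)=\sum_{n\ge 0}D_n^{(h,2)}x^n$ is the rational function $$f_h(x)=\frac{1-\displaystyle\sum_{j=1}^{\lceil h/2\rceil}\frac{3j-h-1}{j}\binom{h-j}{j-1}(-1)^jx^j}{1-\displaystyle\sum_{j=1}^{\lceil (h+1)/2\rceil}\frac{3j-h-2}{j}\binom{h-j+1}{j-1}(-1)^jx^j}.$$
   Context: A Dyck path of semilength $n$ is a lattice path from $(0,0)$ to $(2n,0)$ with up steps $U=(1,1)$ and down steps $D=(1,-1)$ that never goes below the $x$-axis. Its height is the maximum ordinate it reaches. A valley is an occurrence of consecutive steps $DU$; the height of a valley is the ordinate of the endpoint of its $D$ step. $D_n^{(h,2)}$ denotes the number of Dyck paths of semilength $n$ with height at most $h$ and with no valley at height $h-1$ (the empty path is counted for $n=0$). *)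

theory Defs
  imports "HOL-Computational_Algebra.Formal_Power_Series"
begin

datatype step = U | D

fun rise :: "step \<Rightarrow> int" where
  "rise U = 1"
| "rise D = - 1"

(* A lattice path starting at (0,0) is given by its list w of steps. Every step moves
   one unit to the right, so its i-th vertex (0 <= i <= length w) is (i, ordinate w i). *)
definition ordinate :: "step list \<Rightarrow> nat \<Rightarrow> int" where
  "ordinate w i = (\<Sum>s\<leftarrow>take i w. rise s)"

definition dyck_path :: "nat \<Rightarrow> step list \<Rightarrow> bool" where
  "dyck_path n w \<longleftrightarrow>
     length w = 2 * n \<and> ordinate w (2 * n) = 0 \<and> (\<forall>i\<le>2 * n. 0 \<le> ordinate w i)"

definition path_height :: "step list \<Rightarrow> int" where
  "path_height w = Max (ordinate w ` {0..length w})"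

(* The D step of a valley is w ! i, which ends at vertex number Suc i. *)
definition has_valley_at_height :: "step list \<Rightarrow> int \<Rightarrow> bool" where
  "has_valley_at_height w y \<longleftrightarrow>
     (\<exists>i. Suc i < length w \<and> w ! i = D \<and> w ! Suc i = U \<and> ordinate w (Suc i) = y)"

definition dyck_paths_h2 :: "nat \<Rightarrow> nat \<Rightarrow> step list set" where
  "dyck_paths_h2 h n =
     {w. dyck_path n w \<and> path_height w \<le> int h \<and> \<not> has_valley_at_height w (int h - 1)}"

lemma finite_dyck_paths_h2: "finite (dyck_paths_h2 h n)"
proof (rule finite_subset)
  show "dyck_paths_h2 h n \<subseteq> {w. set w \<subseteq> {U, D} \<and> length w = 2 * n}"
    using step.exhaust by (auto simp: dyck_paths_h2_def dyck_path_def)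
  show "finite {w. set w \<subseteq> {U, D} \<and> length w = 2 * n}"
    by (rule finite_lists_length_eq) simp
qed

definition num_dyck_h2 :: "nat \<Rightarrow> nat \<Rightarrow> nat" where
  "num_dyck_h2 h n = card (dyck_paths_h2 h n)"

end

theory Submission
  imports Defs
begin

text \<open>
  Cut a nonempty path counted by \<open>f\<^sub>h\<close> at its first return to the axis, as \<open>U P D Q\<close>.
  Lowering \<open>P\<close> by one turns it into a path counted by \<open>f\<^sub>h\<^sub>-\<^sub>1\<close>, because the height bound and
  the forbidden valley height drop together, and \<open>Q\<close> is again counted by \<open>f\<^sub>h\<close>. The only valley
  created by gluing lies on the axis, so it is harmless exactly when \<open>h \<ge> 2\<close>. This gives
  \<open>f\<^sub>h = 1 + x f\<^sub>h\<^sub>-\<^sub>1 f\<^sub>h\<close> for \<open>h \<ge> 2\<close> (lemma \<open>path_gf_rec\<close>), while \<open>f\<^sub>1 = 1 + x\<close>, since only the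
  empty path and \<open>U D\<close> have height at most one and no valley on the axis.

  Unfolding this as a continued fraction gives \<open>f\<^sub>h = d\<^sub>h\<^sub>-\<^sub>1 / d\<^sub>h\<close>, where \<open>d\<^sub>0 = 1 + x\<close>, \<open>d\<^sub>1 = 1\<close> and
  \<open>d\<^sub>m\<^sub>+\<^sub>2 = d\<^sub>m\<^sub>+\<^sub>1 - x d\<^sub>m\<close>. The Fibonacci polynomials
  \<open>F\<^sub>n = \<Sum>\<^sub>j (n-j choose j) (-x)\<^sup>j\<close> satisfy the same recurrence with \<open>F\<^sub>0 = F\<^sub>1 = 1\<close>, so
  \<open>d\<^sub>m = F\<^sub>m\<^sub>+\<^sub>1 + x F\<^sub>m\<close>. For \<open>j \<ge> 1\<close> the coefficient of \<open>(-x)\<^sup>j\<close> in \<open>d\<^sub>m\<close> is therefore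
  \<open>(m+1-j choose j) - (m+1-j choose j-1)\<close>, and absorbing \<open>j\<close> into the first binomial turns this
  into \<open>- (3j-m-2)/j (m+1-j choose j-1)\<close> (lemma \<open>denom_closed_form\<close>). Thus numerator and denominator
  of the formula are \<open>d\<^sub>h\<^sub>-\<^sub>1\<close> and \<open>d\<^sub>h\<close>.
\<close>

unbundle fps_syntax

section \<open>Paths confined to a strip\<close>

text \<open>
  The path starts at ordinate \<open>k\<close>, stays between \<open>l\<close> and \<open>h\<close>, and has no valley at \<open>h - 1\<close>;
  a valley has that height precisely when its \<open>D\<close> step leaves from \<open>h\<close>. A free starting point
  and a free lower bound make the predicate stable under cutting and shifting paths.
\<close>
fun confined :: "int \<Rightarrow> int \<Rightarrow> int \<Rightarrow> step list \<Rightarrow> bool" where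
  "confined l h k [] \<longleftrightarrow> l \<le> k \<and> k \<le> h"
| "confined l h k (s # w) \<longleftrightarrow> l \<le> k \<and> k \<le> h \<and> (s = D \<and> w \<noteq> [] \<and> hd w = U \<longrightarrow> k \<noteq> h)
     \<and> confined l h (k + rise s) w"

abbreviation total_rise :: "step list \<Rightarrow> int" where
  "total_rise w \<equiv> (\<Sum>s\<leftarrow>w. rise s)"

lemma ordinate_0 [simp]: "ordinate w 0 = 0"
  by (simp add: ordinate_def)

lemma ordinate_Cons_Suc [simp]: "ordinate (s # w) (Suc i) = rise s + ordinate w i"
  by (simp add: ordinate_def)

lemma has_valley_Nil [simp]: "\<not> has_valley_at_height [] y"
  by (simp add: has_valley_at_height_def)

lemma ex_nat_split: "(\<exists>i. P i) \<longleftrightarrow> P 0 \<or> (\<exists>i. P (Suc i))"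
  by (metis not0_implies_Suc)

lemma has_valley_Cons:
  "has_valley_at_height (s # w) y \<longleftrightarrow>
     s = D \<and> w \<noteq> [] \<and> hd w = U \<and> y = -1 \<or> has_valley_at_height w (y - rise s)"
proof -
  have "has_valley_at_height (s # w) y \<longleftrightarrow>
      (\<exists>i. Suc i < length (s # w) \<and> (s # w) ! i = D \<and> (s # w) ! Suc i = U
         \<and> ordinate (s # w) (Suc i) = y)"
    by (simp only: has_valley_at_height_def)
  also have "\<dots> \<longleftrightarrow> (0 < length w \<and> s = D \<and> w ! 0 = U \<and> rise s = y) \<or>
      (\<exists>i. Suc i < length w \<and> w ! i = D \<and> w ! Suc i = U \<and> rise s + ordinate w (Suc i) = y)"
    by (subst ex_nat_split) (auto simp: less_Suc_eq_0_disj)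
  also have "\<dots> \<longleftrightarrow> s = D \<and> w \<noteq> [] \<and> hd w = U \<and> y = -1 \<or> has_valley_at_height w (y - rise s)"
    unfolding has_valley_at_height_def by (auto simp: hd_conv_nth algebra_simps)
  finally show ?thesis .
qed

lemma all_le_Suc_split: "(\<forall>i\<le>Suc n. P i) \<longleftrightarrow> P 0 \<and> (\<forall>i\<le>n. P (Suc i))"
  by (metis Suc_le_mono not0_implies_Suc zero_le)

lemma confined_iff_ordinate:
  "confined l h k w \<longleftrightarrow>
     (\<forall>i\<le>length w. l \<le> k + ordinate w i \<and> k + ordinate w i \<le> h)
     \<and> \<not> has_valley_at_height w (h - 1 - k)"
proof (induction w arbitrary: k)
  case Nil
  then show ?case by simp
next
  case (Cons s w)
  have "h - 1 - (k + rise s) = h - 1 - k - rise s" "(h - 1 - k = - 1) = (k = h)"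
    by auto
  then show ?case
    by (simp only: confined.simps Cons.IH has_valley_Cons list.size add_Suc_right add_0_right
        all_le_Suc_split ordinate_0 ordinate_Cons_Suc add.assoc) auto
qed

lemma dyck_paths_h2_confined:
  "dyck_paths_h2 h n = {w. length w = 2 * n \<and> total_rise w = 0 \<and> confined 0 (int h) 0 w}"
proof -
  have "path_height w \<le> int h \<longleftrightarrow> (\<forall>i\<le>length w. ordinate w i \<le> int h)" for w
    unfolding path_height_def by (subst Max_le_iff) auto
  moreover have "ordinate w (2 * n) = total_rise w" if "length w = 2 * n" for w
    using that by (simp add: ordinate_def)
  ultimately show ?thesis
    unfolding dyck_paths_h2_def dyck_path_def confined_iff_ordinate by auto
qed

lemma confined_start: "confined l h k w \<Longrightarrow> l \<le> k \<and> k \<le> h"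
  by (cases w) auto

lemma confined_append:
  "u \<noteq> [] \<Longrightarrow> confined l h k (u @ v) \<longleftrightarrow> confined l h k u \<and> confined l h (k + total_rise u) v
     \<and> (last u = D \<and> v \<noteq> [] \<and> hd v = U \<longrightarrow> k + total_rise u \<noteq> h - 1)"
proof (induction u arbitrary: k)
  case (Cons s u)
  show ?case
  proof (cases u)
    case Nil
    then show ?thesis by (cases s) (auto dest: confined_start)
  next
    case (Cons t u')
    then show ?thesis using Cons.IH[of "k + rise s"] by (auto simp: algebra_simps)
  qed
qed simp

lemma confined_shift: "confined (l + c) (h + c) (k + c) w \<longleftrightarrow> confined l h k w"
proof (induction w arbitrary: k)
  case (Cons s w)
  have "k + c + rise s = k + rise s + c" by simp
  then show ?case by (simp only: confined.simps Cons.IH) auto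
qed simp

lemma even_total_rise: "even (total_rise w) \<longleftrightarrow> even (length w)"
proof (induction w)
  case (Cons s w)
  then show ?case by (cases s) auto
qed simp

section \<open>The first-return decomposition\<close>

text \<open>
  Used with \<open>l = 0\<close>, \<open>k = 1\<close> for what remains after the initial \<open>U\<close> step: the first descent to
  \<open>l\<close> is then the first return to the axis. The start \<open>k\<close> is free so that induction on the
  path works.
\<close>
lemma first_descent_exists:
  assumes "confined l h k w" "l < k" "k + total_rise w = l"
  shows "\<exists>P Q. w = P @ D # Q \<and> confined (l + 1) h k P \<and> k + total_rise P = l + 1"
  using assms
proof (induction w arbitrary: k)
  case (Cons s w)
  show ?case
  proof (cases "k + rise s = l")
    case True
    with Cons.prems have "s = D" "k = l + 1" by (cases s; simp)+
    with Cons.prems have "s # w = [] @ D # w \<and> confined (l + 1) h k [] \<and> k + total_rise [] = l + 1"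
      by simp
    then show ?thesis by blast
  next
    case False
    with Cons.prems have "l < k + rise s" by (cases s) auto
    moreover have "k + rise s + total_rise w = l" "confined l h (k + rise s) w"
      using Cons.prems by auto
    ultimately obtain P Q where PQ: "w = P @ D # Q" "confined (l + 1) h (k + rise s) P"
      "k + rise s + total_rise P = l + 1"
      using Cons.IH by blast
    have "P \<noteq> [] \<Longrightarrow> hd w = hd P \<and> w \<noteq> []" using PQ(1) by simp
    with PQ Cons.prems have "confined (l + 1) h k (s # P)" by auto
    with PQ have "s # w = (s # P) @ D # Q \<and> confined (l + 1) h k (s # P)
        \<and> k + total_rise (s # P) = l + 1"
      by simp
    then show ?thesis by blast
  qed
qed simp

text \<open>
  Of two such cuts of one path, the later one would have its first piece contain the \<open>D\<close> step of
  the earlier one, which leaves \<open>l\<close> downwards.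
\<close>
lemma first_descent_unique:
  assumes "P @ D # Q = P' @ D # Q'"
    and "confined l h k P" "k + total_rise P = l"
    and "confined l h k P'" "k + total_rise P' = l"
  shows "P = P' \<and> Q = Q'"
  using assms
proof (induction P arbitrary: k P')
  case Nil
  then show ?case by (cases P') (auto dest!: confined_start)
next
  case (Cons s P)
  show ?case
  proof (cases P')
    case Nil
    with Cons.prems show ?thesis by (auto dest!: confined_start)
  next
    case (Cons t P'')
    with Cons.prems Cons.IH[of P'' "k + rise s"] show ?thesis by (simp add: add.assoc)
  qed
qed

text \<open>
  The hypothesis \<open>h > 1\<close> keeps the point where the two pieces are glued, at ordinate \<open>0\<close>, away
  from the forbidden valley height \<open>h - 1\<close>.
\<close>
lemma confined_arch:
  assumes "h > 1" "total_rise P = 0"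
  shows "confined 0 h 0 (U # P @ D # Q) \<and> confined 1 h 1 P \<longleftrightarrow>
    confined 0 (h - 1) 0 P \<and> confined 0 h 0 Q"
proof -
  have shift: "confined 1 h 1 P \<longleftrightarrow> confined 0 (h - 1) 0 P"
    using confined_shift[of 0 1 "h - 1" 0 P] by simp
  have lower: "confined 0 h k w" if "confined 1 h k w" for k w
    using that by (induction w arbitrary: k) auto
  have *: "confined 0 h 1 (P @ D # Q) \<longleftrightarrow> confined 0 h 1 P \<and> confined 0 h 0 Q"
    using assms by (cases "P = []") (auto simp: confined_append)
  show ?thesis using * shift lower assms by auto
qed

lemma num_dyck_h2_0: "num_dyck_h2 h 0 = 1"
proof -
  have "dyck_paths_h2 h 0 = {[]}" by (auto simp: dyck_paths_h2_confined)
  then show ?thesis by (simp add: num_dyck_h2_def)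
qed

lemma num_dyck_h2_rec:
  assumes "h \<ge> 1"
  shows "num_dyck_h2 (Suc h) (Suc n) = (\<Sum>i\<le>n. num_dyck_h2 h i * num_dyck_h2 (Suc h) (n - i))"
proof -
  let ?S = "SIGMA i:{..n}. dyck_paths_h2 h i \<times> dyck_paths_h2 (Suc h) (n - i)"
  let ?g = "\<lambda>(i::nat, P, Q). U # P @ D # Q"
  have arch: "confined 0 (int (Suc h)) 0 (U # P @ D # Q) \<and> confined 1 (int (Suc h)) 1 P \<longleftrightarrow>
      confined 0 (int h) 0 P \<and> confined 0 (int (Suc h)) 0 Q" if "total_rise P = 0" for P Q
    using confined_arch[of "int (Suc h)" P Q] that assms by simp
  have "inj_on ?g ?S"
  proof (rule inj_onI)
    fix x y assume xy: "x \<in> ?S" "y \<in> ?S" "?g x = ?g y"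
    obtain i P Q j P' Q' where x: "x = (i, P, Q)" and y: "y = (j, P', Q')"
      by (metis prod_cases3)
    from xy have a: "P \<in> dyck_paths_h2 h i" "P' \<in> dyck_paths_h2 h j"
      and eq: "P @ D # Q = P' @ D # Q'"
      unfolding x y by auto
    have "P = P' \<and> Q = Q'"
      by (rule first_descent_unique[OF eq, of 0 "int h" 0])
        (use a in \<open>auto simp: dyck_paths_h2_confined\<close>)
    moreover have "2 * i = length P" "2 * j = length P'"
      using a by (auto simp: dyck_paths_h2_confined)
    ultimately show "x = y" unfolding x y by auto
  qed
  then have "card (?g ` ?S) = card ?S" by (rule card_image)
  moreover have "?g ` ?S = dyck_paths_h2 (Suc h) (Suc n)"
  proof
    show "?g ` ?S \<subseteq> dyck_paths_h2 (Suc h) (Suc n)"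
    proof (rule image_subsetI)
      fix x assume "x \<in> ?S"
      then obtain i P Q where "x = (i, P, Q)" "i \<in> {..n}"
        "P \<in> dyck_paths_h2 h i" "Q \<in> dyck_paths_h2 (Suc h) (n - i)"
        by auto
      then show "?g x \<in> dyck_paths_h2 (Suc h) (Suc n)"
        using arch[of P Q] unfolding dyck_paths_h2_confined by simp
    qed
    show "dyck_paths_h2 (Suc h) (Suc n) \<subseteq> ?g ` ?S"
    proof
      fix w assume "w \<in> dyck_paths_h2 (Suc h) (Suc n)"
      then have w: "length w = 2 * Suc n" "total_rise w = 0" "confined 0 (int (Suc h)) 0 w"
        by (auto simp: dyck_paths_h2_confined)
      then obtain s v where sv: "w = s # v" by (cases w) auto
      have "s = U" using w(3) unfolding sv by (cases s) (auto dest: confined_start)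
      with sv have wv: "w = U # v" by simp
      obtain P Q where PQ: "v = P @ D # Q" "confined 1 (int (Suc h)) 1 P" "total_rise P = 0"
        using first_descent_exists[of 0 "int (Suc h)" 1 v] w unfolding wv by auto
      have conf: "confined 0 (int h) 0 P" "confined 0 (int (Suc h)) 0 Q"
        using arch[OF PQ(3), of Q] PQ w(3) unfolding wv by auto
      have "total_rise Q = 0" using w(2) PQ(1,3) wv by simp
      obtain i where i: "length P = 2 * i"
        using even_total_rise[of P] PQ(3) by (auto elim: evenE)
      with w(1) PQ(1) wv have "i \<le> n" "length Q = 2 * (n - i)" by auto
      with i conf PQ(3) \<open>total_rise Q = 0\<close> have "(i, P, Q) \<in> ?S"
        by (auto simp: dyck_paths_h2_confined)
      then have "?g (i, P, Q) \<in> ?g ` ?S" by (rule imageI)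
      then show "w \<in> ?g ` ?S" using wv PQ(1) by simp
    qed
  qed
  ultimately have "num_dyck_h2 (Suc h) (Suc n) = card ?S"
    by (simp only: num_dyck_h2_def)
  also have "\<dots> = (\<Sum>i\<le>n. num_dyck_h2 h i * num_dyck_h2 (Suc h) (n - i))"
    by (subst card_SigmaI)
      (auto simp: num_dyck_h2_def finite_dyck_paths_h2 card_cartesian_product)
  finally show ?thesis .
qed

lemma num_dyck_h2_1: "num_dyck_h2 1 n = (if n \<le> 1 then 1 else 0)"
proof -
  have "w = [] \<or> w = [U, D]" if "confined 0 1 0 w" "total_rise w = 0" for w
  proof (cases w)
    case (Cons s v)
    with that have "s = U" by (cases s) (auto dest: confined_start)
    with Cons that obtain t u where v: "v = t # u" by (cases v) auto
    with Cons that \<open>s = U\<close> have "t = D" by (cases t) (auto dest: confined_start)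
    have "u = []"
    proof (cases u)
      case (Cons r x)
      then show ?thesis
        using that \<open>w = s # v\<close> v \<open>s = U\<close> \<open>t = D\<close> by (cases r) (auto dest: confined_start)
    qed
    with Cons v \<open>s = U\<close> \<open>t = D\<close> show ?thesis by simp
  qed simp
  then have "total_rise w = 0 \<and> confined 0 1 0 w \<longleftrightarrow> w = [] \<or> w = [U, D]" for w
    by auto
  then have "dyck_paths_h2 1 n = {w. length w = 2 * n \<and> (w = [] \<or> w = [U, D])}"
    by (simp add: dyck_paths_h2_confined)
  also have "\<dots> = (if n = 0 then {[]} else if n = 1 then {[U, D]} else {})"
    by auto
  finally show ?thesis by (simp add: num_dyck_h2_def)
qed

section \<open>The generating function as a quotient of Fibonacci-type polynomials\<close>

definition path_gf :: "nat \<Rightarrow> rat fps" where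
  "path_gf h = Abs_fps (\<lambda>n. of_nat (num_dyck_h2 h n))"

lemma path_gf_1: "path_gf 1 = 1 + fps_X"
  by (rule fps_ext) (simp add: path_gf_def num_dyck_h2_1[simplified] fps_X_def)

lemma path_gf_rec:
  assumes "h \<ge> 1"
  shows "path_gf (Suc h) = 1 + fps_X * (path_gf h * path_gf (Suc h))"
proof (rule fps_ext)
  fix n
  show "path_gf (Suc h) $ n = (1 + fps_X * (path_gf h * path_gf (Suc h))) $ n"
  proof (cases n)
    case 0
    then show ?thesis by (simp add: path_gf_def num_dyck_h2_0)
  next
    case (Suc m)
    have "path_gf (Suc h) $ Suc m = (path_gf h * path_gf (Suc h)) $ m"
      using assms by (simp add: path_gf_def num_dyck_h2_rec fps_mult_nth atLeast0AtMost)
    then show ?thesis by (simp add: Suc)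
  qed
qed

definition fib_poly :: "nat \<Rightarrow> rat fps" where
  "fib_poly n = Abs_fps (\<lambda>j. (- 1) ^ j * of_nat ((n - j) choose j))"

lemma fib_poly_0: "fib_poly 0 = 1"
  by (rule fps_ext) (simp add: fib_poly_def binomial_eq_0)

lemma fib_poly_1: "fib_poly (Suc 0) = 1"
  by (rule fps_ext) (auto simp: fib_poly_def binomial_eq_0)

lemma fib_poly_rec: "fib_poly (Suc (Suc n)) = fib_poly (Suc n) - fps_X * fib_poly n"
proof (rule fps_ext)
  fix j
  show "fib_poly (Suc (Suc n)) $ j = (fib_poly (Suc n) - fps_X * fib_poly n) $ j"
  proof (cases j)
    case 0
    then show ?thesis by (simp add: fib_poly_def)
  next
    case (Suc k)
    then show ?thesis
      by (cases "k \<le> n") (auto simp: fib_poly_def Suc_diff_le algebra_simps binomial_eq_0)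
  qed
qed

text \<open>
  The solution of the Fibonacci recurrence that starts with \<open>1 + x\<close>, \<open>1\<close>; its value at index
  \<open>0\<close> is chosen so that \<open>path_gf 1 = denom 0 / denom 1\<close>.
\<close>
definition denom :: "nat \<Rightarrow> rat fps" where
  "denom m = fib_poly (Suc m) + fps_X * fib_poly m"

lemma denom_rec: "denom (Suc (Suc m)) = denom (Suc m) - fps_X * denom m"
  by (simp add: denom_def fib_poly_rec[of "Suc m"] fib_poly_rec[of m] algebra_simps)

lemma denom_0: "denom 0 = 1 + fps_X"
  by (simp add: denom_def fib_poly_0 fib_poly_1)

lemma denom_1: "denom 1 = 1"
  by (simp add: denom_def fib_poly_rec fib_poly_0 fib_poly_1)

lemma denom_nth_0: "denom m $ 0 = 1"
  by (simp add: denom_def fib_poly_def)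

text \<open>
  Multiplying \<open>f\<^sub>m\<^sub>+\<^sub>2 (1 - x f\<^sub>m\<^sub>+\<^sub>1) = 1\<close> by \<open>d\<^sub>m\<^sub>+\<^sub>1\<close> replaces the product \<open>f\<^sub>m\<^sub>+\<^sub>1 d\<^sub>m\<^sub>+\<^sub>1\<close> by \<open>d\<^sub>m\<close>,
  which leaves \<open>f\<^sub>m\<^sub>+\<^sub>2 d\<^sub>m\<^sub>+\<^sub>2 = d\<^sub>m\<^sub>+\<^sub>1\<close>.
\<close>
lemma path_gf_times_denom: "path_gf (Suc m) * denom (Suc m) = denom m"
proof (induction m)
  case 0
  then show ?case using path_gf_1 denom_0 denom_1 by simp
next
  case (Suc m)
  let ?f = "path_gf (Suc m)" and ?g = "path_gf (Suc (Suc m))"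
  have "?g * denom (Suc (Suc m)) = ?g * denom (Suc m) - fps_X * (?g * denom m)"
    by (simp add: denom_rec algebra_simps)
  also have "\<dots> = ?g * denom (Suc m) - fps_X * (?g * (?f * denom (Suc m)))"
    by (simp only: Suc.IH)
  also have "\<dots> = (?g - fps_X * (?f * ?g)) * denom (Suc m)"
    by (simp add: algebra_simps)
  also have "?g - fps_X * (?f * ?g) = 1"
    using path_gf_rec[of "Suc m"] by (simp add: algebra_simps)
  finally show ?case by simp
qed

lemma path_gf_eq_quotient: "path_gf (Suc m) = denom m / denom (Suc m)"
proof -
  have "denom (Suc m) \<noteq> 0" using denom_nth_0[of "Suc m"] by auto
  then show ?thesis
    by (metis nonzero_mult_div_cancel_right path_gf_times_denom)
qed

section \<open>The closed form of the coefficients\<close>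

lemma Suc_times_choose_Suc: "Suc k * (n choose Suc k) = (n - k) * (n choose k)"
  by (metis binomial_absorb_comp binomial_absorption)

lemma choose_diff_eq:
  fixes k m :: nat
  assumes "2 * k \<le> m"
  shows "(3 * of_nat (Suc k) - of_nat m - 2) / of_nat (Suc k) * (of_nat ((m - k) choose k) :: rat)
    = of_nat ((m - k) choose k) - of_nat ((m - k) choose Suc k)"
proof -
  have "of_nat (Suc k) * of_nat ((m - k) choose Suc k)
      = (of_nat (m - k - k) * of_nat ((m - k) choose k) :: rat)"
    by (metis Suc_times_choose_Suc of_nat_mult)
  also have "of_nat (m - k - k) = (of_nat m - 2 * of_nat k :: rat)"
    using assms by (simp add: of_nat_diff)
  finally have *: "of_nat (Suc k) * of_nat ((m - k) choose Suc k)
      = ((of_nat m - 2 * of_nat k) * of_nat ((m - k) choose k) :: rat)" .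
  have "of_nat (Suc k) * (of_nat ((m - k) choose k) - of_nat ((m - k) choose Suc k))
      = ((3 * of_nat (Suc k) - of_nat m - 2) * of_nat ((m - k) choose k) :: rat)"
    by (simp only: right_diff_distrib *) (simp add: algebra_simps)
  then show ?thesis by (simp add: divide_simps del: of_nat_Suc) (simp add: mult.commute)
qed

text \<open>
  Beyond \<open>2 * k \<le> m\<close> both binomials of \<open>choose_diff_eq\<close> vanish, which explains the upper limit of
  the sums in the theorem.
\<close>
lemma denom_nth_Suc:
  "denom m $ Suc k = (if 2 * k \<le> m then
     - ((3 * of_nat (Suc k) - of_nat m - 2) / of_nat (Suc k) * of_nat ((m - k) choose k)
        * (- 1) ^ Suc k) else 0)"
proof (cases "2 * k \<le> m")
  case True
  then have "denom m $ Suc k =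
      - ((of_nat ((m - k) choose k) - of_nat ((m - k) choose Suc k)) * (- 1) ^ Suc k)"
    by (simp add: denom_def fib_poly_def algebra_simps)
  with True show ?thesis by (simp only: choose_diff_eq if_True)
next
  case False
  then show ?thesis by (simp add: denom_def fib_poly_def binomial_eq_0)
qed

lemma fps_sum_monom_nth:
  "(\<Sum>j = 1..N. fps_const (c j) * fps_X ^ j) $ i = (if 1 \<le> i \<and> i \<le> N then c i else (0 :: rat))"
proof -
  have "(\<Sum>j = 1..N. fps_const (c j) * fps_X ^ j) $ i = (\<Sum>j = 1..N. if j = i then c j else 0)"
    unfolding fps_sum_nth by (rule sum.cong) (auto simp: fps_X_power_iff)
  then show ?thesis by (simp add: sum.delta')
qed

lemma nat_ceiling_half: "nat \<lceil>(of_nat n :: rat) / 2\<rceil> = (n + 1) div 2"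
proof -
  have "\<lceil>(of_nat n :: rat) / 2\<rceil> = int ((n + 1) div 2)"
  proof (rule ceiling_unique)
    have "2 * ((n + 1) div 2) < n + 2" by simp
    then have "of_nat (2 * ((n + 1) div 2)) < (of_nat (n + 2) :: rat)" by (simp only: of_nat_less_iff)
    then show "of_int (int ((n + 1) div 2)) - 1 < (of_nat n :: rat) / 2" by simp
    have "n \<le> 2 * ((n + 1) div 2)" by simp
    then have "of_nat n \<le> (of_nat (2 * ((n + 1) div 2)) :: rat)" by (simp only: of_nat_le_iff)
    then show "(of_nat n :: rat) / 2 \<le> of_int (int ((n + 1) div 2))" by simp
  qed
  then show ?thesis by simp
qed

lemma denom_closed_form:
  "1 - (\<Sum>j = 1..nat \<lceil>(of_nat (m + 1) :: rat) / 2\<rceil>.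
      fps_const ((3 * of_nat j - of_nat m - 2) / of_nat j * of_nat ((Suc m - j) choose (j - 1))
        * (- 1) ^ j) * fps_X ^ j) = denom m"
  unfolding nat_ceiling_half
proof (rule fps_ext, unfold fps_sub_nth fps_sum_monom_nth)
  fix i
  show "1 $ i - (if 1 \<le> i \<and> i \<le> (m + 1 + 1) div 2
      then (3 * of_nat i - of_nat m - 2) / of_nat i * of_nat ((Suc m - i) choose (i - 1)) * (- 1) ^ i
      else 0) = denom m $ i"
  proof (cases i)
    case 0
    then show ?thesis by (simp add: denom_nth_0)
  next
    case (Suc k)
    have "Suc k \<le> (m + 1 + 1) div 2 \<longleftrightarrow> 2 * k \<le> m" by presburger
    then show ?thesis unfolding Suc denom_nth_Suc by (simp del: of_nat_Suc)
  qed
qed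

theorem mainTheorem2:
  fixes h :: nat
  assumes "h \<ge> 2"
  shows "Abs_fps (\<lambda>n. of_nat (num_dyck_h2 h n) :: rat) =
    (1 - (\<Sum>j = 1..nat \<lceil>(of_nat h :: rat) / 2\<rceil>.
            fps_const ((3 * of_nat j - of_nat h - 1) / of_nat j * of_nat ((h - j) choose (j - 1)) * (- 1) ^ j)
            * fps_X ^ j)) /
    (1 - (\<Sum>j = 1..nat \<lceil>(of_nat (h + 1) :: rat) / 2\<rceil>.
            fps_const ((3 * of_nat j - of_nat h - 2) / of_nat j * of_nat ((h - j + 1) choose (j - 1)) * (- 1) ^ j)
            * fps_X ^ j))"
    (is "_ = ?N / ?M")
proof -
  obtain m where h: "h = Suc m" using assms by (cases h) auto
  have "?N = denom m"
    unfolding denom_closed_form[symmetric] h by (simp add: algebra_simps)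
  moreover have "?M = denom h"
  proof -
    (* For h > 1 the summation index is at most h, so truncated subtraction is harmless. *)
    have "h - j + 1 = Suc h - j" if "j \<in> {1..nat \<lceil>(of_nat (h + 1) :: rat) / 2\<rceil>}" for j
      using that assms unfolding nat_ceiling_half by auto
    then show ?thesis
      unfolding denom_closed_form[symmetric] by (intro arg_cong2[of _ _ _ _ "(-)"] sum.cong) simp_all
  qed
  ultimately show ?thesis
    using path_gf_eq_quotient[of m] by (simp add: path_gf_def h)
qed

end
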